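(* Let $H = (V,E)$ be a hypertree such that $|e|$ is prime for each $e \in E$. Then the chromatic symmetric function $X_H$ is $F$-positive.
   Context: A hypergraph is a pair $H=(V,E)$ with $V$ finite and $E$ a family of subsets of $V$ with $|e|>1$ for each $e\in E$. A path is a sequence $v_1, e_1, v_2, \ldots, e_m, v_{m+1}$ with $e_i \in E$, $v_i, v_{i+1} \in e_i$, the edges distinct and the vertices distinct except that $v_1 = v_{m+1}$ is allowed; if $v_1 = v_{m+1}$ and $m>1$ it is a cycle. A hypertree is a connected (any two vertices joined by a path) hypergraph with no cycles. A coloring $\chi: V \to \mathbb{P}=\{1,2,\ldots\}$ is proper if no edge is monochromatic (i.e. $\chi$ is nonconstant on each $e\in E$). $X_H = \sum_\chi \prod_{v \in V} x_{\chi(v)}$, summed over proper colorings, a symmetric function in commuting variables $x_1,x_2,\ldots$. With $n=|V|$, for $S \subseteq [n-1]$ the fundamental quasisymmetric function is $F_S = \sum x_{i_1}\cdots x_{i_n}$ over all $i_1 \le \cdots \le i_n$ in $\mathbb{P}$ with $i_j < i_{j+1}$ whenever $j \in S$. $X_H$ is $F$-positive if all coefficients in its expansion $X_H = \sum_S a_S F_S$ are nonnegative. *)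

theory Defs
  imports Main "HOL-Library.FuncSet" "HOL-Computational_Algebra.Primes"
begin

definition hypergraph :: "'a set \<Rightarrow> 'a set set \<Rightarrow> bool" where
  "hypergraph V E \<longleftrightarrow> finite V \<and> (\<forall>e\<in>E. e \<subseteq> V \<and> card e > 1)"

definition hpath :: "'a set set \<Rightarrow> 'a list \<Rightarrow> 'a set list \<Rightarrow> bool" where
  "hpath E vs es \<longleftrightarrow>
     length vs = length es + 1 \<and> set es \<subseteq> E \<and> distinct es \<and>
     (\<forall>i < length es. vs ! i \<in> es ! i \<and> vs ! (i+1) \<in> es ! i) \<and>
     (\<forall>i j. i < j \<and> j \<le> length es \<and> \<not> (i = 0 \<and> j = length es) \<longrightarrow> vs ! i \<noteq> vs ! j)"

definition hcycle :: "'a set set \<Rightarrow> 'a list \<Rightarrow> 'a set list \<Rightarrow> bool" where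
  "hcycle E vs es \<longleftrightarrow> hpath E vs es \<and> hd vs = last vs \<and> length es > 1"

definition hconnected :: "'a set \<Rightarrow> 'a set set \<Rightarrow> bool" where
  "hconnected V E \<longleftrightarrow>
     (\<forall>u\<in>V. \<forall>v\<in>V. \<exists>vs es. hpath E vs es \<and> hd vs = u \<and> last vs = v)"

definition hypertree :: "'a set \<Rightarrow> 'a set set \<Rightarrow> bool" where
  "hypertree V E \<longleftrightarrow> hypergraph V E \<and> hconnected V E \<and> \<not> (\<exists>vs es. hcycle E vs es)"

definition proper_colorings :: "'a set \<Rightarrow> 'a set set \<Rightarrow> ('a \<Rightarrow> nat) set" where
  "proper_colorings V E =
     {\<chi> \<in> V \<rightarrow>\<^sub>E {1..}. \<forall>e\<in>E. \<not> (\<exists>c. \<forall>v\<in>e. \<chi> v = c)}"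

text \<open>Formal power series in x_1, x_2, ... are identified with their coefficient functions on
  monomials; a monomial \<prod> x_i^(m i) is given by its exponent function m.
  Coefficient of x^m in X_H = number of proper colourings with exactly m i vertices of colour i.\<close>
definition chrom_coeff :: "'a set \<Rightarrow> 'a set set \<Rightarrow> (nat \<Rightarrow> nat) \<Rightarrow> int" where
  "chrom_coeff V E m =
     int (card {\<chi> \<in> proper_colorings V E. \<forall>i. card {v \<in> V. \<chi> v = i} = m i})"

text \<open>Coefficient of x^m in the fundamental quasisymmetric function F_S of degree n:
  number of sequences i_1 \<le> ... \<le> i_n in P, strict at positions j \<in> S, with content m.\<close>
definition fund_coeff :: "nat \<Rightarrow> nat set \<Rightarrow> (nat \<Rightarrow> nat) \<Rightarrow> int" where
  "fund_coeff n S m =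
     int (card {s \<in> {1..n} \<rightarrow>\<^sub>E {1..}.
                 (\<forall>j \<in> {1..<n}. s j \<le> s (j+1) \<and> (j \<in> S \<longrightarrow> s j < s (j+1))) \<and>
                 (\<forall>i. card {j \<in> {1..n}. s j = i} = m i)})"

definition F_positive :: "'a set \<Rightarrow> 'a set set \<Rightarrow> bool" where
  "F_positive V E \<longleftrightarrow>
     (\<exists>a :: nat set \<Rightarrow> int.
        (\<forall>S. S \<subseteq> {1..<card V} \<longrightarrow> a S \<ge> 0) \<and>
        (\<forall>m. chrom_coeff V E m =
              (\<Sum>S \<in> Pow {1..<card V}. a S * fund_coeff (card V) S m)))"

end

theory Submission
  imports Defs "HOL-Library.Product_Lexorder" "HOL-Number_Theory.Cong"
begin

text \<open>
  Arrange the vertices of an edge \<open>e\<close> of prime size \<open>p\<close> on a cycle. A colouring that is not constant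
  on \<open>e\<close> has between \<open>1\<close> and \<open>p - 1\<close> cyclic descents there, and cutting the cycle one vertex later
  changes the major index of the resulting word modulo \<open>p\<close> by this number, which is invertible.
  Hence exactly one cut gives a major index congruent to \<open>1\<close>; for a colouring constant on \<open>e\<close> none
  does. Since the hypergraph has no cycles, the linear orders on the edges given by any choice of
  cuts extend to a linear order on \<open>V\<close>. Breaking ties by it turns a proper colouring into a
  bijection \<open>V \<rightarrow> {1..n}\<close> that has the same descents on the cut edges, hence the same cuts.
  The proper colourings with a given standardization \<open>\<pi>\<close> therefore contribute exactly \<open>F\<^sub>S\<close>,
  with \<open>S\<close> the descent set of the inverse of \<open>\<pi>\<close> for the order that \<open>\<pi>\<close> determines.
\<close>

section \<open>Standardization\<close>

text \<open>This is the standardization of a word, with equal colours ranked by increasing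
  \<open>w\<close>. Nothing is fixed outside \<open>V\<close>, so a standardization is determined on
  \<open>V\<close> only.\<close>

definition standardizes :: "'a set \<Rightarrow> ('a \<Rightarrow> nat) \<Rightarrow> ('a \<Rightarrow> nat) \<Rightarrow> ('a \<Rightarrow> nat) \<Rightarrow> bool" where
  "standardizes V w \<chi> \<pi> \<longleftrightarrow> bij_betw \<pi> V {1..card V} \<and>
     (\<forall>u\<in>V. \<forall>v\<in>V. \<pi> u < \<pi> v \<longleftrightarrow> \<chi> u < \<chi> v \<or> \<chi> u = \<chi> v \<and> w u < w v)"

text \<open>The rank of \<open>v\<close> in the lexicographic order of the pairs
  \<open>(\<chi> v, w v)\<close> works; these pairs are distinct because \<open>w\<close> is
  injective on \<open>V\<close>.\<close>

lemma standardization_exists: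
  assumes "finite V" and "inj_on w V"
  obtains \<pi> where "\<pi> \<in> extensional V" "standardizes V w \<chi> \<pi>"
proof -
  define key where "key v = (\<chi> v, w v)" for v
  define \<pi> where "\<pi> = (\<lambda>v\<in>V. card {u \<in> V. key u \<le> key v})"
  have mono: "\<pi> u < \<pi> v" if "u \<in> V" "v \<in> V" "key u < key v" for u v
  proof -
    have "{x \<in> V. key x \<le> key u} \<subset> {x \<in> V. key x \<le> key v}"
    proof (rule psubsetI)
      show "{x \<in> V. key x \<le> key u} \<subseteq> {x \<in> V. key x \<le> key v}"
        using that(3) by (auto intro: order.trans)
      have "v \<notin> {x \<in> V. key x \<le> key u}" using that(3) by (simp add: not_le)
      then show "{x \<in> V. key x \<le> key u} \<noteq> {x \<in> V. key x \<le> key v}"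
        using that(2) by blast
    qed
    then show ?thesis
      using that \<open>finite V\<close> by (auto simp: \<pi>_def intro: psubset_card_mono)
  qed
  have key_inj: "u = v" if "u \<in> V" "v \<in> V" "key u = key v" for u v
    using that \<open>inj_on w V\<close> by (auto simp: key_def inj_on_def)
  have iff: "\<pi> u < \<pi> v \<longleftrightarrow> key u < key v" if "u \<in> V" "v \<in> V" for u v
    using mono[of u v] mono[of v u] key_inj[of u v] that
    by (cases "key u" "key v" rule: linorder_cases) auto
  have inj: "inj_on \<pi> V"
  proof (rule inj_onI)
    fix u v assume uv: "u \<in> V" "v \<in> V" "\<pi> u = \<pi> v"
    then have "\<not> key u < key v" "\<not> key v < key u" using iff[of u v] iff[of v u] by simp_all
    then show "u = v" using key_inj uv by simp
  qed
  have "\<pi> ` V \<subseteq> {1..card V}"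
  proof
    fix y assume "y \<in> \<pi> ` V"
    then obtain v where v: "v \<in> V" "y = card {u \<in> V. key u \<le> key v}"
      by (auto simp: \<pi>_def)
    have "{u \<in> V. key u \<le> key v} \<noteq> {}" using v by auto
    then have "y \<ge> 1" using v \<open>finite V\<close> by (simp add: Suc_le_eq card_gt_0_iff)
    moreover have "y \<le> card V" using v \<open>finite V\<close> by (auto intro: card_mono)
    ultimately show "y \<in> {1..card V}" by simp
  qed
  then have "\<pi> ` V = {1..card V}"
    using inj by (intro card_subset_eq) (auto simp: card_image)
  then have "standardizes V w \<chi> \<pi>"
    using inj iff by (auto simp: standardizes_def bij_betw_def key_def)
  moreover have "\<pi> \<in> extensional V" by (simp add: \<pi>_def)
  ultimately show thesis using that by blast
qed

text \<open>A bijection onto \<open>{1..n}\<close> is recovered from the order it induces. The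
  negated comparison lets the condition in \<open>standardizes\<close> rewrite the set, which makes
  standardizations unique.\<close>

lemma bij_betw_rank:
  fixes \<pi> :: "'a \<Rightarrow> nat"
  assumes "bij_betw \<pi> V {1..n}" and "v \<in> V"
  shows "\<pi> v = card {u \<in> V. \<not> \<pi> v < \<pi> u}"
proof -
  have "\<pi> v \<le> n" using bij_betw_apply[OF assms] by simp
  have "\<pi> ` {u \<in> V. \<not> \<pi> v < \<pi> u} = {1..\<pi> v}"
  proof -
    have "\<pi> ` V = {1..n}" using assms(1) by (simp add: bij_betw_def)
    moreover have "\<pi> ` {u \<in> V. \<not> \<pi> v < \<pi> u} = \<pi> ` V \<inter> {..\<pi> v}" by (auto simp: not_less)
    ultimately show ?thesis using \<open>\<pi> v \<le> n\<close> by auto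
  qed
  moreover have "inj_on \<pi> {u \<in> V. \<not> \<pi> v < \<pi> u}"
    using assms(1) by (auto simp: bij_betw_def inj_on_def)
  ultimately have "card {u \<in> V. \<not> \<pi> v < \<pi> u} = card {1..\<pi> v}"
    by (metis card_image)
  then show ?thesis by simp
qed

lemma standardization_unique:
  assumes "standardizes V w \<chi> \<pi>" and "standardizes V w \<chi> \<pi>'" and "v \<in> V"
  shows "\<pi> v = \<pi>' v"
proof -
  have "{u \<in> V. \<not> \<pi> v < \<pi> u} = {u \<in> V. \<not> \<pi>' v < \<pi>' u}"
    using assms by (auto simp: standardizes_def)
  then show ?thesis
    using assms bij_betw_rank[of \<pi> V "card V" v] bij_betw_rank[of \<pi>' V "card V" v]
    by (simp add: standardizes_def)
qed

text \<open>This is the descent set of the word of labels \<open>w\<close> when the vertices are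
  listed in the order of \<open>\<pi>\<close>.\<close>

definition inv_descents :: "'a set \<Rightarrow> ('a \<Rightarrow> nat) \<Rightarrow> ('a \<Rightarrow> nat) \<Rightarrow> nat set" where
  "inv_descents V w \<pi> =
     {j \<in> {1..<card V}. w (inv_into V \<pi> (j + 1)) < w (inv_into V \<pi> j)}"

text \<open>By transitivity the lexicographic comparison has to be checked for consecutive ranks
  only. There it says that \<open>s\<close> may stay constant where the label ascends and must
  increase where it descends, which is the condition defining a fundamental quasisymmetric
  function.\<close>

lemma standardizes_iff_strict_at_descents:
  assumes inj: "inj_on w V" and bij: "bij_betw \<pi> V {1..card V}"
    and \<chi>: "\<And>v. v \<in> V \<Longrightarrow> \<chi> v = s (\<pi> v)"
  shows "standardizes V w \<chi> \<pi> \<longleftrightarrow>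
    (\<forall>j\<in>{1..<card V}. s j \<le> s (j+1) \<and> (j \<in> inv_descents V w \<pi> \<longrightarrow> s j < s (j+1)))"
    (is "_ \<longleftrightarrow> ?R")
proof
  define q where "q = inv_into V \<pi>"
  have q: "q j \<in> V" "\<pi> (q j) = j" if "j \<in> {1..card V}" for j
    using bij that unfolding q_def
    by (metis bij_betw_def inv_into_into, metis bij_betw_inv_into_right)
  have q\<pi>: "q (\<pi> v) = v" if "v \<in> V" for v
    using bij that unfolding q_def by (simp add: bij_betw_inv_into_left)
  {
    assume std: "standardizes V w \<chi> \<pi>"
    show ?R
    proof
      fix j assume j: "j \<in> {1..<card V}"
      then have "q j \<in> V" "q (j+1) \<in> V" "\<pi> (q j) = j" "\<pi> (q (j+1)) = j+1"
        using q[of j] q[of "j+1"] by auto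
      then have "s j < s (j+1) \<or> s j = s (j+1) \<and> w (q j) < w (q (j+1))"
        using std[unfolded standardizes_def, THEN conjunct2, rule_format, of "q j" "q (j+1)"] \<chi>
        by simp
      then show "s j \<le> s (j+1) \<and> (j \<in> inv_descents V w \<pi> \<longrightarrow> s j < s (j+1))"
        by (auto simp: inv_descents_def q_def)
    qed
  }
  {
    assume R: ?R
    have step: "s j < s (j+1) \<or> s j = s (j+1) \<and> w (q j) < w (q (j+1))"
      if j: "j \<in> {1..<card V}" for j
    proof -
      have "q j \<in> V" "q (j+1) \<in> V" "q j \<noteq> q (j+1)"
        using q[of j] q[of "j+1"] j by auto
      then have "w (q j) \<noteq> w (q (j+1))" using inj by (auto simp: inj_on_def)
      moreover have "s j \<le> s (j+1)" using R j by blast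
      moreover have "s j < s (j+1)" if "w (q (j+1)) < w (q j)"
        using R j that by (auto simp: inv_descents_def q_def)
      ultimately show ?thesis by linarith
    qed
    have chain: "s a < s b \<or> s a = s b \<and> w (q a) < w (q b)"
      if "a < b" "1 \<le> a" "b \<le> card V" for a b
      using that
    proof (induction b)
      case 0
      then show ?case by simp
    next
      case (Suc b)
      have st: "s b < s (Suc b) \<or> s b = s (Suc b) \<and> w (q b) < w (q (Suc b))"
        using step[of b] Suc.prems by auto
      show ?case
      proof (cases "a = b")
        case True
        then show ?thesis using st by simp
      next
        case False
        then show ?thesis using Suc st by auto
      qed
    qed
    have lt: "\<chi> u < \<chi> v \<or> \<chi> u = \<chi> v \<and> w u < w v"
      if "u \<in> V" "v \<in> V" "\<pi> u < \<pi> v" for u v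
    proof -
      have "\<pi> u \<in> {1..card V}" "\<pi> v \<in> {1..card V}"
        using bij that by (auto simp: bij_betw_def)
      then show ?thesis using chain[of "\<pi> u" "\<pi> v"] that \<chi> q\<pi> by simp
    qed
    \<comment> \<open>Since the order of ranks is total, the converse of \<open>lt\<close> follows
      from \<open>lt\<close> itself by asymmetry.\<close>
    have "\<pi> u < \<pi> v"
      if "u \<in> V" "v \<in> V" "\<chi> u < \<chi> v \<or> \<chi> u = \<chi> v \<and> w u < w v" for u v
    proof (rule ccontr)
      assume "\<not> \<pi> u < \<pi> v"
      then consider "\<pi> v < \<pi> u" | "\<pi> u = \<pi> v" by linarith
      then show False
      proof cases
        case 1
        then show False using lt[of v u] that by linarith
      next
        case 2
        then have "u = v" using that q\<pi> by metis
        then show False using that by simp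
      qed
    qed
    then show "standardizes V w \<chi> \<pi>"
      using bij lt unfolding standardizes_def by blast
  }
qed

definition fund_seqs :: "nat \<Rightarrow> nat set \<Rightarrow> (nat \<Rightarrow> nat) \<Rightarrow> (nat \<Rightarrow> nat) set" where
  "fund_seqs n S m =
     {s \<in> {1..n} \<rightarrow>\<^sub>E {1..}.
       (\<forall>j \<in> {1..<n}. s j \<le> s (j+1) \<and> (j \<in> S \<longrightarrow> s j < s (j+1))) \<and>
       (\<forall>i. card {j \<in> {1..n}. s j = i} = m i)}"

text \<open>The codomain is infinite, but the values of every member form the support of
  \<open>m\<close>, so a single member already makes this support finite.\<close>

lemma finite_fund_seqs: "finite (fund_seqs n S m)"
proof (cases "fund_seqs n S m = {}")
  case False
  have supp: "s ` {1..n} = {i. m i \<noteq> 0}" if "s \<in> fund_seqs n S m" for s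
  proof -
    have "m i = card {j \<in> {1..n}. s j = i}" for i
      using that by (simp add: fund_seqs_def)
    then have "m i \<noteq> 0 \<longleftrightarrow> (\<exists>j\<in>{1..n}. s j = i)" for i
      by auto
    then have "{i. m i \<noteq> 0} = {i. \<exists>j\<in>{1..n}. s j = i}" by presburger
    then show ?thesis by auto
  qed
  obtain s where "s \<in> fund_seqs n S m" using False by blast
  from supp[OF this] have "finite {i. m i \<noteq> 0}"
    by (metis finite_atLeastAtMost finite_imageI)
  then have "finite ({1..n} \<rightarrow>\<^sub>E {i. m i \<noteq> 0})" by (intro finite_PiE) auto
  moreover have "fund_seqs n S m \<subseteq> {1..n} \<rightarrow>\<^sub>E {i. m i \<noteq> 0}"
  proof
    fix s assume s: "s \<in> fund_seqs n S m"
    then have "s \<in> extensional {1..n}" by (auto simp: fund_seqs_def PiE_def)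
    with supp[OF s] show "s \<in> {1..n} \<rightarrow>\<^sub>E {i. m i \<noteq> 0}" by (auto simp: PiE_def)
  qed
  ultimately show ?thesis by (rule rev_finite_subset)
qed simp

text \<open>The labelling used to break ties may depend on the colouring through a parameter \<open>k\<close>,
  as long as \<open>k\<close> can be recovered from the standardization.\<close>

lemma F_positive_if_standardizable:
  fixes \<omega> :: "'k \<Rightarrow> 'a \<Rightarrow> nat" and Good :: "'k \<Rightarrow> ('a \<Rightarrow> nat) \<Rightarrow> bool"
  assumes fin: "finite V"
    and inj: "\<And>k. k \<in> K \<Longrightarrow> inj_on (\<omega> k) V"
    and std: "\<And>k \<chi> \<pi>. k \<in> K \<Longrightarrow> standardizes V (\<omega> k) \<chi> \<pi> \<Longrightarrow> Good k \<chi> \<longleftrightarrow> Good k \<pi>"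
    and uniq: "\<And>k k' \<chi>. k \<in> K \<Longrightarrow> k' \<in> K \<Longrightarrow> Good k \<chi> \<Longrightarrow> Good k' \<chi> \<Longrightarrow> k = k'"
    and exist: "\<And>\<pi>. bij_betw \<pi> V {1..card V} \<Longrightarrow> \<exists>k\<in>K. Good k \<pi>"
    and proper: "\<And>\<chi>. \<chi> \<in> V \<rightarrow>\<^sub>E {1..} \<Longrightarrow> \<chi> \<in> proper_colorings V E \<longleftrightarrow> (\<exists>k\<in>K. Good k \<chi>)"
  shows "F_positive V E"
proof -
  define n where "n = card V"
  \<comment> \<open>Extensionality makes each bijection a single function, so that \<open>P\<close>
    is finite and can be counted.\<close>
  define P where "P = {\<pi> \<in> extensional V. bij_betw \<pi> V {1..n}}"
  \<comment> \<open>For a bijection \<open>\<pi>\<close>, \<open>exist\<close> and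
    \<open>uniq\<close> leave exactly one parameter, so the labelling attached to
    \<open>\<pi>\<close> depends on \<open>\<pi>\<close> alone.\<close>
  define \<kappa> where "\<kappa> \<pi> = (SOME k. k \<in> K \<and> Good k \<pi>)" for \<pi>
  define D where "D \<pi> = inv_descents V (\<omega> (\<kappa> \<pi>)) \<pi>" for \<pi>
  define a where "a S = int (card {\<pi> \<in> P. D \<pi> = S})" for S
  have \<kappa>: "\<kappa> \<pi> \<in> K" "Good (\<kappa> \<pi>) \<pi>" if "bij_betw \<pi> V {1..n}" for \<pi>
  proof -
    have "\<exists>k. k \<in> K \<and> Good k \<pi>" using exist that unfolding n_def by blast
    then have "\<kappa> \<pi> \<in> K \<and> Good (\<kappa> \<pi>) \<pi>" unfolding \<kappa>_def by (rule someI_ex)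
    then show "\<kappa> \<pi> \<in> K" "Good (\<kappa> \<pi>) \<pi>" by simp_all
  qed
  have "P \<subseteq> V \<rightarrow>\<^sub>E {1..n}" by (auto simp: P_def PiE_def bij_betw_def)
  then have finP: "finite P" using fin by (meson finite_PiE finite_atLeastAtMost finite_subset)
  have main: "chrom_coeff V E m = (\<Sum>S \<in> Pow {1..<n}. a S * fund_coeff n S m)" for m
  proof -
    define C where "C = {\<chi> \<in> proper_colorings V E. \<forall>i. card {v \<in> V. \<chi> v = i} = m i}"
    define Q where "Q = (SIGMA \<pi>:P. fund_seqs n (D \<pi>) m)"
    \<comment> \<open>\<open>\<Phi>\<close> undoes standardization: the vertex of rank
      \<open>j\<close> receives the entry \<open>s j\<close>. It will be a bijection from
      \<open>Q\<close> to \<open>C\<close>, so counting \<open>Q\<close> gives the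
      coefficient.\<close>
    define \<Phi> where "\<Phi> = (\<lambda>(\<pi>, s). \<lambda>v\<in>V. s (\<pi> v :: nat) :: nat)"
    have content: "card {v \<in> V. \<chi> v = i} = card {j \<in> {1..n}. s j = i}"
      if "bij_betw \<pi> V {1..n}" "\<And>v. v \<in> V \<Longrightarrow> \<chi> v = s (\<pi> v)" for \<pi> s and \<chi> :: "'a \<Rightarrow> nat" and i
    proof -
      have "\<pi> ` V = {1..n}" using that(1) by (simp add: bij_betw_def)
      moreover have "\<pi> ` {v \<in> V. \<chi> v = i} = {j \<in> \<pi> ` V. s j = i}" using that(2) by auto
      ultimately have image: "\<pi> ` {v \<in> V. \<chi> v = i} = {j \<in> {1..n}. s j = i}" by simp
      have "inj_on \<pi> {v \<in> V. \<chi> v = i}"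
        using that(1) by (auto simp: bij_betw_def intro: inj_on_subset)
      from card_image[OF this] show ?thesis unfolding image by (rule sym)
    qed
    have \<Phi>std: "standardizes V (\<omega> (\<kappa> \<pi>)) (\<Phi> (\<pi>, s)) \<pi>" "Good (\<kappa> \<pi>) (\<Phi> (\<pi>, s))"
      if "(\<pi>, s) \<in> Q" for \<pi> s
    proof -
      have bij: "bij_betw \<pi> V {1..card V}" and s: "s \<in> fund_seqs n (D \<pi>) m"
        using that by (auto simp: Q_def P_def n_def)
      have k: "\<kappa> \<pi> \<in> K" "Good (\<kappa> \<pi>) \<pi>" using \<kappa> bij by (auto simp: n_def)
      show *: "standardizes V (\<omega> (\<kappa> \<pi>)) (\<Phi> (\<pi>, s)) \<pi>"
        using s standardizes_iff_strict_at_descents[OF inj[OF k(1)] bij, of "\<Phi> (\<pi>, s)" s]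
        by (simp add: \<Phi>_def fund_seqs_def D_def n_def)
      show "Good (\<kappa> \<pi>) (\<Phi> (\<pi>, s))" using std[OF k(1) *] k(2) by simp
    qed
    have "inj_on \<Phi> Q"
    proof (rule inj_onI)
      fix x y assume xy: "x \<in> Q" "y \<in> Q" "\<Phi> x = \<Phi> y"
      obtain \<pi> s \<pi>' s' where x: "x = (\<pi>, s)" and y: "y = (\<pi>', s')" by (meson surj_pair)
      have Q: "(\<pi>, s) \<in> Q" "(\<pi>', s') \<in> Q" and eq: "\<Phi> (\<pi>, s) = \<Phi> (\<pi>', s')"
        using xy x y by simp_all
      have bij: "bij_betw \<pi> V {1..n}" "bij_betw \<pi>' V {1..n}"
        and ext: "\<pi> \<in> extensional V" "\<pi>' \<in> extensional V"
        and exts: "s \<in> extensional {1..n}" "s' \<in> extensional {1..n}"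
        using Q by (auto simp: Q_def P_def fund_seqs_def PiE_def)
      \<comment> \<open>Both parameters are good for the common colouring. Only once they agree are
        \<open>\<pi>\<close> and \<open>\<pi>'\<close> standardizations with respect to the same
        labelling.\<close>
      have "\<kappa> \<pi> = \<kappa> \<pi>'"
        using uniq[OF \<kappa>(1)[OF bij(1)] \<kappa>(1)[OF bij(2)] \<Phi>std(2)[OF Q(1)]]
          \<Phi>std(2)[OF Q(2)] eq by simp
      then have "\<pi> v = \<pi>' v" if "v \<in> V" for v
        using standardization_unique[OF \<Phi>std(1)[OF Q(1)], of \<pi>' v] \<Phi>std(1)[OF Q(2)] eq that
        by simp
      then have \<pi>: "\<pi> = \<pi>'" using ext by (intro extensionalityI[of _ V]) auto
      have "s j = s' j" if "j \<in> {1..n}" for j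
      proof -
        have "j \<in> \<pi> ` V" using bij(1) that by (simp add: bij_betw_def)
        then obtain v where v: "v \<in> V" "j = \<pi> v" by blast
        then show ?thesis using fun_cong[OF eq, of v] \<pi> by (simp add: \<Phi>_def)
      qed
      then have "s = s'" using exts by (intro extensionalityI[of _ "{1..n}"]) auto
      with \<pi> show "x = y" by (simp add: x y)
    qed
    moreover have "\<Phi> ` Q \<subseteq> C"
    proof
      fix \<chi> assume "\<chi> \<in> \<Phi> ` Q"
      then obtain \<pi> s where Q: "(\<pi>, s) \<in> Q" and \<chi>: "\<chi> = \<Phi> (\<pi>, s)" by auto
      have bij: "bij_betw \<pi> V {1..n}" and s: "s \<in> {1..n} \<rightarrow>\<^sub>E {1..}"
        and cs: "\<And>i. card {j \<in> {1..n}. s j = i} = m i"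
        using Q by (auto simp: Q_def P_def fund_seqs_def)
      have "\<chi> \<in> V \<rightarrow>\<^sub>E {1..}"
        unfolding \<chi> \<Phi>_def using PiE_mem[OF s] bij_betw_apply[OF bij] by simp
      then have "\<chi> \<in> proper_colorings V E"
        using proper[of \<chi>] \<Phi>std(2)[OF Q] \<kappa>(1)[OF bij] unfolding \<chi> by blast
      moreover have "card {v \<in> V. \<chi> v = i} = m i" for i
        using content[OF bij, of \<chi> s i] cs by (simp add: \<chi> \<Phi>_def)
      ultimately show "\<chi> \<in> C" by (simp add: C_def)
    qed
    moreover have "C \<subseteq> \<Phi> ` Q"
    proof
      fix \<chi> assume C: "\<chi> \<in> C"
      then have col: "\<chi> \<in> proper_colorings V E" and ext: "\<chi> \<in> V \<rightarrow>\<^sub>E {1..}"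
        by (auto simp: C_def proper_colorings_def)
      then obtain k where k: "k \<in> K" "Good k \<chi>" using proper by blast
      obtain \<pi> where \<pi>: "\<pi> \<in> extensional V" "standardizes V (\<omega> k) \<chi> \<pi>"
        by (rule standardization_exists[OF fin inj[OF k(1)], of \<chi>])
      have bij: "bij_betw \<pi> V {1..n}" using \<pi> by (simp add: standardizes_def n_def)
      \<comment> \<open>Goodness passes from \<open>\<chi>\<close> to its standardization, so the
        parameter of \<open>\<chi>\<close> can be read off from \<open>\<pi>\<close>, and
        \<open>D \<pi>\<close> refers to the labelling that was used.\<close>
      have "Good k \<pi>" using std[OF k(1) \<pi>(2)] k by simp
      then have k\<pi>: "\<kappa> \<pi> = k" using uniq k(1) \<kappa>[OF bij] by blast
      define s where "s = (\<lambda>j\<in>{1..n}. \<chi> (inv_into V \<pi> j))"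
      have s\<pi>: "\<chi> v = s (\<pi> v)" if "v \<in> V" for v
        using bij_betw_apply[OF bij that] bij_betw_inv_into_left[OF bij that] by (simp add: s_def)
      have "inv_into V \<pi> j \<in> V" if "j \<in> {1..n}" for j
        using bij that by (metis bij_betw_def inv_into_into)
      then have "s \<in> {1..n} \<rightarrow>\<^sub>E {1..}"
        using ext by (auto simp: s_def PiE_def Pi_def)
      moreover have "\<forall>j\<in>{1..<n}. s j \<le> s (j+1) \<and> (j \<in> D \<pi> \<longrightarrow> s j < s (j+1))"
        using standardizes_iff_strict_at_descents[OF inj[OF k(1)], of \<pi> \<chi> s] bij s\<pi> \<pi>(2) k\<pi>
        by (simp add: n_def D_def)
      moreover have "card {j \<in> {1..n}. s j = i} = m i" for i
        using content[OF bij, of \<chi> s i] s\<pi> C by (simp add: C_def)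
      ultimately have "(\<pi>, s) \<in> Q"
        using \<pi> bij by (simp add: Q_def P_def fund_seqs_def)
      moreover have "\<chi> = \<Phi> (\<pi>, s)"
        using ext s\<pi> by (intro extensionalityI[of _ V]) (auto simp: \<Phi>_def PiE_def)
      ultimately show "\<chi> \<in> \<Phi> ` Q" by blast
    qed
    ultimately have "card C = card Q" by (metis card_image subset_antisym)
    also have "\<dots> = (\<Sum>\<pi>\<in>P. card (fund_seqs n (D \<pi>) m))"
      using finP finite_fund_seqs by (simp add: Q_def)
    also have "\<dots> = (\<Sum>S\<in>Pow {1..<n}. \<Sum>\<pi>\<in>{\<pi>\<in>P. D \<pi> = S}. card (fund_seqs n (D \<pi>) m))"
      using finP by (intro sum.group[symmetric]) (auto simp: D_def inv_descents_def n_def)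
    also have "\<dots> = (\<Sum>S\<in>Pow {1..<n}. card {\<pi>\<in>P. D \<pi> = S} * card (fund_seqs n S m))"
      by (intro sum.cong) auto
    finally show ?thesis
      unfolding chrom_coeff_def C_def[symmetric] fund_coeff_def fund_seqs_def[symmetric] a_def
      by simp
  qed
  show ?thesis
    unfolding F_positive_def
    by (rule exI[of _ a]) (use main in \<open>auto simp: a_def n_def\<close>)
qed

section \<open>Cyclic descents\<close>

definition cyc_descents :: "nat \<Rightarrow> (nat \<Rightarrow> nat) \<Rightarrow> nat set" where
  "cyc_descents p g = {i \<in> {..<p}. g (Suc i mod p) < g i}"

text \<open>Up to a multiple of \<open>p\<close>, the sum is the major index of the word
  \<open>g r, g (r + 1), \<dots>, g (r + p - 1)\<close> (indices modulo \<open>p\<close>): a cyclic descent at \<open>i\<close> becomes the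
  descent at position \<open>i + 1 - r\<close>, and a descent across the cut contributes \<open>0\<close> modulo \<open>p\<close>.
  The residue \<open>1\<close> is what excludes constant words.\<close>

definition good_rotation :: "nat \<Rightarrow> nat \<Rightarrow> (nat \<Rightarrow> nat) \<Rightarrow> bool" where
  "good_rotation p r g \<longleftrightarrow> [(\<Sum>i\<in>cyc_descents p g. int i + 1 - int r) = 1] (mod int p)"

text \<open>Without cyclic descents the values rise weakly all the way round the cycle and come back
  to the start, so they are constant.\<close>

lemma cyc_descents_nonempty:
  assumes "i < p" "j < p" "g i \<noteq> g j"
  shows "cyc_descents p g \<noteq> {}"
proof
  assume "cyc_descents p g = {}"
  then have le: "g l \<le> g (Suc l mod p)" if "l < p" for l
  proof -
    have "l \<notin> cyc_descents p g" using \<open>cyc_descents p g = {}\<close> by simp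
    then show ?thesis using that by (simp add: cyc_descents_def)
  qed
  have mono: "g a \<le> g (a + d)" if "a + d < p" for a d
    using that
  proof (induction d)
    case (Suc d)
    then show ?case using le[of "a + d"] by simp
  qed simp
  \<comment> \<open>\<open>g 0 \<le> g l \<le> g (p - 1) \<le> g 0\<close>, where the last
    inequality is the wrap-around step.\<close>
  have "g l = g 0" if "l < p" for l
    using mono[of 0 l] mono[of l "p - 1 - l"] le[of "p - 1"] that by simp
  then show False using assms by metis
qed

text \<open>A position of the minimal value is not a cyclic descent.\<close>

lemma card_cyc_descents_less:
  assumes "0 < p"
  shows "card (cyc_descents p g) < p"
proof -
  obtain i where i: "i < p" "\<And>j. j < p \<Longrightarrow> g i \<le> g j"
    using assms ex_min_if_finite[of "g ` {..<p}"] by (auto simp: not_less)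
  then have "i \<notin> cyc_descents p g"
    using assms by (auto simp: cyc_descents_def not_less)
  then have "cyc_descents p g \<subset> {..<p}"
    using i by (auto simp: cyc_descents_def)
  then show ?thesis by (metis card_lessThan finite_lessThan psubset_card_mono)
qed

text \<open>Goodness of \<open>r\<close> is the linear congruence \<open>d * r = A - 1\<close>
  modulo \<open>p\<close>, where \<open>d\<close> is the number of cyclic descents. As
  \<open>0 < d < p\<close> and \<open>p\<close> is prime, \<open>d\<close> is invertible. This is
  where the primality of the edge sizes enters.\<close>

lemma ex1_good_rotation:
  assumes "prime p" and "i < p" "j < p" "g i \<noteq> g j"
  shows "\<exists>!r. r < p \<and> good_rotation p r g"
proof -
  define d where "d = int (card (cyc_descents p g))"
  define A where "A = (\<Sum>i\<in>cyc_descents p g. int i + 1)"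
  have "p > 0" using assms(1) prime_gt_0_nat by blast
  have "finite (cyc_descents p g)" by (simp add: cyc_descents_def)
  then have "0 < card (cyc_descents p g)" "card (cyc_descents p g) < p"
    using cyc_descents_nonempty[OF assms(2-4)] card_cyc_descents_less[OF \<open>p > 0\<close>]
    by (auto simp: card_gt_0_iff)
  then have "coprime (card (cyc_descents p g)) p"
    using assms(1) by (metis coprime_commute nat_dvd_not_less prime_imp_coprime_nat)
  then have cop: "coprime d (int p)" by (simp add: d_def)
  have good: "good_rotation p r g \<longleftrightarrow> [d * int r = A - 1] (mod int p)" for r
  proof -
    have "(\<Sum>i\<in>cyc_descents p g. int i + 1 - int r) = A - d * int r"
      by (simp add: A_def d_def sum_subtractf)
    then have "good_rotation p r g \<longleftrightarrow> int p dvd A - d * int r - 1"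
      by (simp add: good_rotation_def cong_iff_dvd_diff)
    also have "\<dots> \<longleftrightarrow> int p dvd d * int r - (A - 1)"
      by (subst dvd_minus_iff[symmetric]) (simp add: algebra_simps)
    finally show ?thesis by (simp add: cong_iff_dvd_diff)
  qed
  obtain x where x: "[d * x = 1] (mod int p)"
    using cop cong_solve_coprime_int by blast
  \<comment> \<open>\<open>x\<close> inverts \<open>d\<close> modulo \<open>p\<close>, so
    \<open>x * (A - 1)\<close> solves the congruence. The remainder modulo \<open>p\<close> is
    nonnegative, hence \<open>nat\<close> loses nothing.\<close>
  define r where "r = nat ((x * (A - 1)) mod int p)"
  have r: "int r = (x * (A - 1)) mod int p" using \<open>p > 0\<close> by (simp add: r_def)
  have "[d * int r = d * (x * (A - 1))] (mod int p)"
    unfolding r by (intro cong_mult) (auto simp: cong_def)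
  also have "d * (x * (A - 1)) = d * x * (A - 1)" by simp
  also have "[\<dots> = 1 * (A - 1)] (mod int p)" using x by (intro cong_mult) auto
  finally have "good_rotation p r g" by (simp add: good)
  moreover have "int r < int p" unfolding r using \<open>p > 0\<close> by simp
  then have "r < p" by simp
  moreover have "r' = r''" if "r' < p" "good_rotation p r' g" "r'' < p" "good_rotation p r'' g" for r' r''
  proof -
    have "[d * int r' = d * int r''] (mod int p)"
      using that good by (simp add: cong_def)
    then have "[int r' = int r''] (mod int p)"
      using cop by (simp add: cong_mult_lcancel)
    then show ?thesis using that by (simp add: cong_int_iff cong_def)
  qed
  ultimately show ?thesis by blast
qed

lemma not_good_rotation_const:
  assumes "1 < p" and "\<And>i. i < p \<Longrightarrow> g i = c"
  shows "\<not> good_rotation p r g"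
proof -
  have "cyc_descents p g = {}" using assms by (auto simp: cyc_descents_def)
  then show ?thesis using assms(1) by (simp add: good_rotation_def cong_def)
qed

text \<open>The step across the cut, where \<open>Suc i mod p = r\<close>, has a summand divisible
  by \<open>p\<close>, so it does not matter whether it is a descent. Standardization controls only
  the other steps.\<close>

lemma good_rotation_cong:
  assumes "0 < p"
    and same: "\<And>i. i < p \<Longrightarrow> Suc i mod p \<noteq> r \<Longrightarrow> g (Suc i mod p) < g i \<longleftrightarrow> h (Suc i mod p) < h i"
  shows "good_rotation p r g \<longleftrightarrow> good_rotation p r h"
proof -
  define D where "D f = {i \<in> cyc_descents p f. Suc i mod p \<noteq> r}" for f
  have *: "[(\<Sum>i\<in>cyc_descents p f. int i + 1 - int r) = (\<Sum>i\<in>D f. int i + 1 - int r)] (mod int p)" for f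
  proof -
    have "(\<Sum>i\<in>cyc_descents p f. int i + 1 - int r) =
        (\<Sum>i\<in>D f. int i + 1 - int r) + (\<Sum>i\<in>cyc_descents p f - D f. int i + 1 - int r)"
      by (subst add.commute, rule sum.subset_diff) (auto simp: D_def cyc_descents_def)
    moreover have "int p dvd (\<Sum>i\<in>cyc_descents p f - D f. int i + 1 - int r)"
    proof (rule dvd_sum)
      fix i assume "i \<in> cyc_descents p f - D f"
      then have "r = Suc i mod p" by (auto simp: D_def)
      then have "int r = (int i + 1) mod int p" by (simp add: zmod_int add.commute)
      then show "int p dvd int i + 1 - int r" by simp
    qed
    ultimately show ?thesis by (simp add: cong_iff_dvd_diff)
  qed
  have "D g = D h" using same by (auto simp: D_def cyc_descents_def)
  then show ?thesis
    using *[of g] *[of h] by (simp only: good_rotation_def cong_def)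
qed

text \<open>\<open>(i + p - r) mod p\<close> is the position of \<open>i\<close> when the cycle is
  read from \<open>r\<close>; adding \<open>p\<close> first avoids truncated subtraction. The cases
  are the step from \<open>p - 1\<close> to \<open>0\<close>, a step after the cut and a step before
  it.\<close>

lemma rotated_index_less:
  fixes i p r :: nat
  assumes "i < p" "r < p" "Suc i mod p \<noteq> r"
  shows "(i + p - r) mod p < (Suc i mod p + p - r) mod p"
proof -
  have lt: "x mod p = x" if "x < p" for x using that by simp
  have ge: "x mod p = x - p" if "p \<le> x" "x < 2 * p" for x
    using that by (simp add: le_mod_geq)
  consider "Suc i = p" | "Suc i < p" "r \<le> i" | "Suc i < p" "Suc i < r"
    using assms by (cases "Suc i < p"; cases "r \<le> i") auto
  then show ?thesis
  proof cases
    case 1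
    then have "r \<noteq> 0" using assms by simp
    then show ?thesis using 1 assms ge[of "i + p - r"] lt[of "p - r"] by simp
  next
    case 2
    then show ?thesis using assms ge[of "i + p - r"] ge[of "Suc i + p - r"] by simp
  next
    case 3
    then show ?thesis using assms lt[of "i + p - r"] lt[of "Suc i + p - r"] by simp
  qed
qed

section \<open>Compatible labellings of acyclic hypergraphs\<close>

text \<open>A shortest closed walk along the edge orders has distinct vertices and distinct edges
  and is not a loop, so it would be a cycle of the hypergraph.\<close>

lemma acyclic_edge_orders:
  fixes l :: "'a set \<Rightarrow> 'a \<Rightarrow> nat"
  assumes nocyc: "\<not> (\<exists>vs es. hcycle E vs es)"
  shows "acyclic {(u, v). \<exists>e\<in>E. u \<in> e \<and> v \<in> e \<and> l e u < l e v}"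
proof (rule ccontr)
  define R where "R = {(u, v). \<exists>e\<in>E. u \<in> e \<and> v \<in> e \<and> l e u < l e v}"
  assume "\<not> acyclic {(u, v). \<exists>e\<in>E. u \<in> e \<and> v \<in> e \<and> l e u < l e v}"
  then obtain x0 where "(x0, x0) \<in> R\<^sup>+" unfolding R_def[symmetric] acyclic_def by blast
  then have ex: "\<exists>k. 0 < k \<and> (\<exists>x. (x, x) \<in> R ^^ k)" unfolding trancl_power by blast
  define k where "k = (LEAST k. 0 < k \<and> (\<exists>x. (x, x) \<in> R ^^ k))"
  obtain x where k0: "0 < k" and x: "(x, x) \<in> R ^^ k"
    using LeastI_ex[OF ex] unfolding k_def by blast
  have least: "(y, y) \<notin> R ^^ j" if "0 < j" "j < k" for y j
    using not_less_Least[of j "\<lambda>k. 0 < k \<and> (\<exists>x. (x, x) \<in> R ^^ k)"] that unfolding k_def by blast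
  obtain f where f: "f 0 = x" "f k = x" "\<And>i. i < k \<Longrightarrow> (f i, f (Suc i)) \<in> R"
    using x unfolding relpow_fun_conv by blast
  have seg: "(f i, f j) \<in> R ^^ (j - i)" if "i \<le> j" "j \<le> k" for i j
    unfolding relpow_fun_conv
    by (rule exI[of _ "\<lambda>t. f (i + t)"]) (use that f in auto)
  have "\<forall>i. \<exists>e. i < k \<longrightarrow> e \<in> E \<and> f i \<in> e \<and> f (Suc i) \<in> e \<and> l e (f i) < l e (f (Suc i))"
    using f(3) unfolding R_def by blast
  then obtain ed where ed: "\<And>i. i < k \<Longrightarrow>
      ed i \<in> E \<and> f i \<in> ed i \<and> f (Suc i) \<in> ed i \<and> l (ed i) (f i) < l (ed i) (f (Suc i))"
    by metis
  \<comment> \<open>A repeated vertex would cut off a shorter closed walk.\<close>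
  have fdist: "f i \<noteq> f j" if "i < j" "j \<le> k" "\<not> (i = 0 \<and> j = k)" for i j
  proof -
    have "0 < j - i" "j - i < k" using that by auto
    then show ?thesis using seg[of i j] least[of "j - i" "f i"] that by auto
  qed
  have eddist: "ed i \<noteq> ed j" if "i < j" "j < k" for i j
  proof
    assume eq: "ed i = ed j"
    let ?l = "l (ed i)"
    have i: "f i \<in> ed i" "f (Suc i) \<in> ed i" "?l (f i) < ?l (f (Suc i))" "ed i \<in> E"
      using ed[of i] that by auto
    have j: "f j \<in> ed i" "f (Suc j) \<in> ed i" "?l (f j) < ?l (f (Suc j))"
      using ed[of j] that eq by auto
    \<comment> \<open>Two steps in one edge allow a shortcut. Either \<open>f i\<close> goes
      directly to \<open>f (Suc j)\<close>, leaving a closed walk of length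
      \<open>k - j + i\<close>, or the linear order forces \<open>f j\<close> below
      \<open>f (Suc i)\<close>, which closes the middle part with length
      \<open>j - i\<close>.\<close>
    show False
    proof (cases "?l (f i) < ?l (f (Suc j))")
      case True
      then have "(f i, f (Suc j)) \<in> R" using i j unfolding R_def by blast
      moreover have "(f (Suc j), f k) \<in> R ^^ (k - Suc j)" "(f k, f i) \<in> R ^^ i"
        using seg[of "Suc j" k] seg[of 0 i] that f(1,2) by auto
      then have "(f (Suc j), f i) \<in> R ^^ (k - Suc j + i)" by (auto simp: relpow_add)
      ultimately have "(f i, f i) \<in> R ^^ Suc (k - Suc j + i)" by (meson relpow_Suc_I2)
      moreover have "Suc (k - Suc j + i) < k" using that by simp
      ultimately show False using least[of "Suc (k - Suc j + i)"] by blast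
    next
      case False
      then have "(f j, f (Suc i)) \<in> R" using i j unfolding R_def by force
      moreover have "(f (Suc i), f j) \<in> R ^^ (j - Suc i)" using seg[of "Suc i" j] that by simp
      ultimately have "(f j, f j) \<in> R ^^ Suc (j - Suc i)" by (meson relpow_Suc_I2)
      moreover have "Suc (j - Suc i) < k" using that by simp
      ultimately show False using least[of "Suc (j - Suc i)"] by blast
    qed
  qed
  have "k \<noteq> 1"
  proof
    assume "k = 1"
    then show False using ed[of 0] f by simp
  qed
  then have "k > 1" using k0 by simp
  have "hcycle E (map f [0..<Suc k]) (map ed [0..<k])"
    unfolding hcycle_def hpath_def
  proof (intro conjI allI impI)
    show "distinct (map ed [0..<k])"
      unfolding distinct_map inj_on_def
      using eddist by auto (metis linorder_neqE_nat)
    show "set (map ed [0..<k]) \<subseteq> E" using ed by auto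
    show "hd (map f [0..<Suc k]) = last (map f [0..<Suc k])"
      using f by (simp add: hd_map last_map del: upt_Suc)
  next
    fix i assume "i < length (map ed [0..<k])"
    then show "map f [0..<Suc k] ! i \<in> map ed [0..<k] ! i"
      and "map f [0..<Suc k] ! (i+1) \<in> map ed [0..<k] ! i"
      using ed[of i] by (auto simp del: upt_Suc)
  next
    fix i j assume "i < j \<and> j \<le> length (map ed [0..<k]) \<and> \<not> (i = 0 \<and> j = length (map ed [0..<k]))"
    then show "map f [0..<Suc k] ! i \<noteq> map f [0..<Suc k] ! j"
      using fdist[of i j] by (simp del: upt_Suc)
  qed (use \<open>k > 1\<close> in auto)
  then show False using nocyc by blast
qed

text \<open>Induction on \<open>V\<close>: a minimal vertex gets the label \<open>0\<close>, and the
  labels of the others are shifted up by one.\<close>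

lemma acyclic_linear_labelling:
  assumes "finite V" and "acyclic R"
  shows "\<exists>w :: 'a \<Rightarrow> nat. inj_on w V \<and> (\<forall>u\<in>V. \<forall>v\<in>V. (u, v) \<in> R \<longrightarrow> w u < w v)"
  using assms(1)
proof (induction V rule: finite_psubset_induct)
  case (psubset V)
  show ?case
  proof (cases "V = {}")
    case False
    have "acyclic (R \<inter> V \<times> V)" using assms(2) acyclic_subset by blast
    then have "wf (R \<inter> V \<times> V)" using psubset.hyps by (intro finite_acyclic_wf) auto
    then obtain z where z: "z \<in> V" "\<And>y. (y, z) \<in> R \<inter> V \<times> V \<Longrightarrow> y \<notin> V"
      using False by (metis all_not_in_conv wfE_min)
    obtain w :: "'a \<Rightarrow> nat" where w: "inj_on w (V - {z})"
      "\<forall>u\<in>V-{z}. \<forall>v\<in>V-{z}. (u, v) \<in> R \<longrightarrow> w u < w v"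
      using psubset.IH[of "V - {z}"] z by blast
    define w' where "w' v = (if v = z then 0 else Suc (w v))" for v
    have "inj_on w' V" using w(1) by (auto simp: w'_def inj_on_def)
    moreover have "w' u < w' v" if "u \<in> V" "v \<in> V" "(u, v) \<in> R" for u v
      using that z(2)[of u] w(2) assms(2) by (auto simp: w'_def)
    ultimately show ?thesis by blast
  qed simp
qed

section \<open>Hypertrees with edges of prime size\<close>

theorem theorem3p3:
  fixes V :: "'a set" and E :: "'a set set"
  assumes "hypertree V E"
    and "\<forall>e\<in>E. prime (card e)"
  shows "F_positive V E"
proof -
  have fin: "finite V" and sub: "\<And>e. e \<in> E \<Longrightarrow> e \<subseteq> V" and big: "\<And>e. e \<in> E \<Longrightarrow> 1 < card e"
    and nocyc: "\<not> (\<exists>vs es. hcycle E vs es)"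
    using assms(1) by (auto simp: hypertree_def hypergraph_def)
  have finE: "finite e" if "e \<in> E" for e using sub[OF that] fin finite_subset by blast
  \<comment> \<open>An arbitrary enumeration, read modulo \<open>card e\<close>, serves as the
    cyclic arrangement of \<open>e\<close>.\<close>
  have "\<forall>e. \<exists>c. e \<in> E \<longrightarrow> bij_betw c {..<card e} e"
    using finE ex_bij_betw_nat_finite by (metis atLeast0LessThan)
  then obtain c where c: "\<And>e. e \<in> E \<Longrightarrow> bij_betw (c e) {..<card e} e" by metis
  have cin: "c e i \<in> e" if "e \<in> E" "i < card e" for e i
    using c[OF that(1)] that(2) by (auto dest: bij_betw_apply)
  have cex: "\<exists>i<card e. v = c e i" if "e \<in> E" "v \<in> e" for e v
    using c[OF that(1)] that(2) by (auto simp: bij_betw_def)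
  \<comment> \<open>A parameter chooses one cut for every edge; extensionality makes it determined
    by these cuts.\<close>
  define K where "K = (\<Pi>\<^sub>E e\<in>E. {..<card e})"
  define Good where "Good k \<chi> \<longleftrightarrow> (\<forall>e\<in>E. good_rotation (card e) (k e) (\<chi> \<circ> c e))"
    for k and \<chi> :: "'a \<Rightarrow> nat"
  have ex1: "\<exists>!r. r < card e \<and> good_rotation (card e) r (\<chi> \<circ> c e)"
    if "e \<in> E" "u \<in> e" "v \<in> e" "\<chi> u \<noteq> \<chi> v" for e u v and \<chi> :: "'a \<Rightarrow> nat"
  proof -
    obtain i j where "i < card e" "j < card e" "u = c e i" "v = c e j"
      using cex[OF \<open>e \<in> E\<close> \<open>u \<in> e\<close>] cex[OF \<open>e \<in> E\<close> \<open>v \<in> e\<close>] by blast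
    then show ?thesis using ex1_good_rotation[of "card e" i j "\<chi> \<circ> c e"] assms(2) that by simp
  qed
  have nonconst: "\<exists>u\<in>e. \<exists>v\<in>e. \<chi> u \<noteq> \<chi> v"
    if "e \<in> E" "good_rotation (card e) r (\<chi> \<circ> c e)" for e r and \<chi> :: "'a \<Rightarrow> nat"
  proof (rule ccontr)
    assume "\<not> ?thesis"
    then have const: "\<chi> u = \<chi> v" if "u \<in> e" "v \<in> e" for u v using that by blast
    have "(\<chi> \<circ> c e) i = \<chi> (c e 0)" if "i < card e" for i
      using const[OF cin[OF \<open>e \<in> E\<close> that] cin[OF \<open>e \<in> E\<close>, of 0]] that by simp
    then show False
      using not_good_rotation_const[OF big[OF that(1)], of "\<chi> \<circ> c e" "\<chi> (c e 0)" r] that(2) by blast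
  qed
  have Good_ex: "\<exists>k\<in>K. Good k \<chi>" if nc: "\<And>e. e \<in> E \<Longrightarrow> \<exists>u\<in>e. \<exists>v\<in>e. \<chi> u \<noteq> \<chi> v" for \<chi>
  proof -
    have "\<forall>e\<in>E. \<exists>r. r < card e \<and> good_rotation (card e) r (\<chi> \<circ> c e)"
    proof
      fix e assume e: "e \<in> E"
      obtain u v where "u \<in> e" "v \<in> e" "\<chi> u \<noteq> \<chi> v" using nc[OF e] by blast
      then show "\<exists>r. r < card e \<and> good_rotation (card e) r (\<chi> \<circ> c e)"
        using ex1[OF e, of u v \<chi>] by blast
    qed
    then obtain k where "\<forall>e\<in>E. k e < card e \<and> good_rotation (card e) (k e) (\<chi> \<circ> c e)"
      by metis
    then show ?thesis
      by (intro bexI[of _ "restrict k E"]) (auto simp: K_def Good_def)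
  qed
  \<comment> \<open>The labels are to increase along each edge read from its cut. This is claimed
    for all \<open>k\<close>, not only those in \<open>K\<close>, so that \<open>choice\<close>
    yields a function of \<open>k\<close>.\<close>
  have "\<forall>k. \<exists>w :: 'a \<Rightarrow> nat. inj_on w V \<and> (\<forall>e\<in>E. \<forall>i<card e. \<forall>j<card e.
      (i + card e - k e) mod card e < (j + card e - k e) mod card e \<longrightarrow> w (c e i) < w (c e j))"
  proof
    fix k
    define l where "l e v = (inv_into {..<card e} (c e) v + card e - k e) mod card e" for e v
    have l: "l e (c e i) = (i + card e - k e) mod card e" if "e \<in> E" "i < card e" for e i
      using c[OF that(1)] that(2) by (simp add: l_def bij_betw_inv_into_left)
    obtain w :: "'a \<Rightarrow> nat" where w: "inj_on w V" and
      mono: "\<And>u v. u \<in> V \<Longrightarrow> v \<in> V \<Longrightarrow> \<exists>e\<in>E. u \<in> e \<and> v \<in> e \<and> l e u < l e v \<Longrightarrow> w u < w v"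
      using acyclic_linear_labelling[OF fin acyclic_edge_orders[OF nocyc, of l]] by auto
    have "w (c e i) < w (c e j)"
      if "e \<in> E" "i < card e" "j < card e"
        "(i + card e - k e) mod card e < (j + card e - k e) mod card e" for e i j
    proof (rule mono)
      have ij: "c e i \<in> e" "c e j \<in> e" using cin that by simp_all
      then show "c e i \<in> V" "c e j \<in> V" using sub[OF that(1)] by auto
      have "l e (c e i) < l e (c e j)" using that by (simp add: l)
      then show "\<exists>e'\<in>E. c e i \<in> e' \<and> c e j \<in> e' \<and> l e' (c e i) < l e' (c e j)"
        using ij that(1) by blast
    qed
    then show "\<exists>w :: 'a \<Rightarrow> nat. inj_on w V \<and> (\<forall>e\<in>E. \<forall>i<card e. \<forall>j<card e.
        (i + card e - k e) mod card e < (j + card e - k e) mod card e \<longrightarrow> w (c e i) < w (c e j))"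
      using w by blast
  qed
  from choice[OF this]
  obtain \<omega> :: "('a set \<Rightarrow> nat) \<Rightarrow> 'a \<Rightarrow> nat" where \<omega>inj: "\<And>k. inj_on (\<omega> k) V"
    and \<omega>: "\<And>k e i j. e \<in> E \<Longrightarrow> i < card e \<Longrightarrow> j < card e \<Longrightarrow>
      (i + card e - k e) mod card e < (j + card e - k e) mod card e \<Longrightarrow> \<omega> k (c e i) < \<omega> k (c e j)"
    by blast
  show ?thesis
  proof (rule F_positive_if_standardizable[of V K \<omega> Good])
    \<comment> \<open>Ties are broken upwards along each cut edge, so \<open>\<chi>\<close> and
      \<open>\<pi>\<close> have the same descents there; the step across the cut is ignored by
      \<open>good_rotation_cong\<close>.\<close>
    show "Good k \<chi> \<longleftrightarrow> Good k \<pi>" if "k \<in> K" "standardizes V (\<omega> k) \<chi> \<pi>" for k \<chi> \<pi>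
      unfolding Good_def
    proof (rule ball_cong[OF refl])
      fix e assume e: "e \<in> E"
      define p where "p = card e"
      have p: "1 < p" "k e < p" using big[OF e] that(1) e by (auto simp: p_def K_def)
      have "\<chi> (c e (Suc i mod p)) < \<chi> (c e i) \<longleftrightarrow> \<pi> (c e (Suc i mod p)) < \<pi> (c e i)"
        if i: "i < p" "Suc i mod p \<noteq> k e" for i
      proof -
        have i': "Suc i mod p < p" using p by simp
        have "\<omega> k (c e i) < \<omega> k (c e (Suc i mod p))"
          using \<omega>[OF e, of i "Suc i mod p" k] rotated_index_less[OF i(1) p(2) i(2)] i i'
          by (simp add: p_def)
        moreover have "c e i \<in> V" "c e (Suc i mod p) \<in> V"
          using cin[OF e] sub[OF e] i i' by (auto simp: p_def)
        ultimately show ?thesis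
          using \<open>standardizes V (\<omega> k) \<chi> \<pi>\<close> unfolding standardizes_def by (metis less_asym)
      qed
      then show "good_rotation (card e) (k e) (\<chi> \<circ> c e) \<longleftrightarrow> good_rotation (card e) (k e) (\<pi> \<circ> c e)"
        using p by (intro good_rotation_cong) (auto simp: p_def)
    qed
    show "k = k'" if "k \<in> K" "k' \<in> K" "Good k \<chi>" "Good k' \<chi>" for k k' \<chi>
    proof (rule PiE_ext[of k E "\<lambda>e. {..<card e}" k'])
      fix e assume e: "e \<in> E"
      then obtain u v where "u \<in> e" "v \<in> e" "\<chi> u \<noteq> \<chi> v"
        using nonconst \<open>Good k \<chi>\<close> unfolding Good_def by blast
      moreover have "k e < card e" "k' e < card e" using that(1,2) e by (auto simp: K_def)
      ultimately show "k e = k' e"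
        using ex1[OF e, of u v \<chi>] e that(3,4) unfolding Good_def by blast
    qed (use that in \<open>auto simp: K_def\<close>)
    show "\<exists>k\<in>K. Good k \<pi>" if "bij_betw \<pi> V {1..card V}" for \<pi>
    proof (rule Good_ex)
      fix e assume e: "e \<in> E"
      \<comment> \<open>An edge has at least two vertices, and an injective \<open>\<pi>\<close>
        separates them.\<close>
      have "c e 0 \<noteq> c e 1" "c e 0 \<in> e" "c e 1 \<in> e"
        using c[OF e] big[OF e] cin[OF e] by (auto simp: bij_betw_def inj_on_def)
      then show "\<exists>u\<in>e. \<exists>v\<in>e. \<pi> u \<noteq> \<pi> v"
        using that sub[OF e] unfolding bij_betw_def inj_on_def by blast
    qed
    show "\<chi> \<in> proper_colorings V E \<longleftrightarrow> (\<exists>k\<in>K. Good k \<chi>)" if "\<chi> \<in> V \<rightarrow>\<^sub>E {1..}" for \<chi>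
    proof -
      have "(\<forall>c. \<exists>v\<in>e. \<chi> v \<noteq> c) \<longleftrightarrow> (\<exists>u\<in>e. \<exists>v\<in>e. \<chi> u \<noteq> \<chi> v)" for e by metis
      then have "\<chi> \<in> proper_colorings V E \<longleftrightarrow> (\<forall>e\<in>E. \<exists>u\<in>e. \<exists>v\<in>e. \<chi> u \<noteq> \<chi> v)"
        using that by (simp add: proper_colorings_def)
      also have "\<dots> \<longleftrightarrow> (\<exists>k\<in>K. Good k \<chi>)"
      proof
        assume "\<forall>e\<in>E. \<exists>u\<in>e. \<exists>v\<in>e. \<chi> u \<noteq> \<chi> v"
        then show "\<exists>k\<in>K. Good k \<chi>" by (intro Good_ex) (rule bspec)
      next
        assume "\<exists>k\<in>K. Good k \<chi>"
        then obtain k where good: "Good k \<chi>" by blast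
        show "\<forall>e\<in>E. \<exists>u\<in>e. \<exists>v\<in>e. \<chi> u \<noteq> \<chi> v"
        proof
          fix e assume e: "e \<in> E"
          then have "good_rotation (card e) (k e) (\<chi> \<circ> c e)" using good by (simp add: Good_def)
          with e show "\<exists>u\<in>e. \<exists>v\<in>e. \<chi> u \<noteq> \<chi> v" by (rule nonconst)
        qed
      qed
      finally show ?thesis .
    qed
  qed (use fin \<omega>inj in auto)
qed

end
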